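(* Let $\nu>0$ and let $f$ be a locally univalent harmonic mapping in $\mathbb{D}$. If $f\in\mathcal{B}^*_H(\nu)$, then $f\in\mathcal{B}_H(\nu+1/2)$. Moreover, the constant $1/2$ is sharp for each $\nu>0$: for every real $c<1/2$ with $\nu+c>0$ there is a locally univalent harmonic mapping $f\in\mathcal{B}^*_H(\nu)$ with $f\notin\mathcal{B}_H(\nu+c)$.
   Context: $\mathbb{D}$ is the open unit disk in $\mathbb{C}$. A harmonic mapping in $\mathbb{D}$ is a complex-valued $f$ with $f_{z\overline z}=0$; its canonical decomposition is $f=h+\overline g$ with $h,g$ analytic in $\mathbb{D}$, $g(0)=0$. Its Jacobian is $J_f=|h'|^2-|g'|^2$. By Lewy's theorem, $f$ is locally univalent iff $J_f\ne0$ in $\mathbb{D}$. For $\nu>0$: $\mathcal{B}_H(\nu)$ is the set of harmonic mappings $f=h+\overline g$ in $\mathbb{D}$ with $\sup_{z\in\mathbb{D}}(1-|z|^2)^\nu(|h'(z)|+|g'(z)|)<\infty$; $\mathcal{B}^*_H(\nu)$ is the set of harmonic mappings $f$ in $\mathbb{D}$ with $\sup_{z\in\mathbb{D}}(1-|z|^2)^\nu\sqrt{|J_f(z)|}<\infty$. *)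

theory Defs
  imports "HOL-Complex_Analysis.Complex_Analysis"
begin

abbreviation unit_disk :: "complex set" where
  "unit_disk \<equiv> ball 0 1"

text \<open>The partial derivatives of \<open>f\<close> in \<open>x\<close> and \<open>y\<close> are the values of its real Frechet
  derivative at \<open>1\<close> and \<open>\<i>\<close>.\<close>

definition wirtinger :: "(complex \<Rightarrow> complex) \<Rightarrow> complex \<Rightarrow> complex" where
  "wirtinger f z =
     (frechet_derivative f (at z) 1 - \<i> * frechet_derivative f (at z) \<i>) / 2"

definition wirtinger_bar :: "(complex \<Rightarrow> complex) \<Rightarrow> complex \<Rightarrow> complex" where
  "wirtinger_bar f z =
     (frechet_derivative f (at z) 1 + \<i> * frechet_derivative f (at z) \<i>) / 2"

text \<open>Real continuous differentiability, for open \<open>S\<close>: the partial derivatives are linear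
  combinations of the two Wirtinger derivatives.\<close>

definition C1_on :: "complex set \<Rightarrow> (complex \<Rightarrow> complex) \<Rightarrow> bool" where
  "C1_on S f \<longleftrightarrow> f differentiable_on S \<and>
     continuous_on S (wirtinger f) \<and> continuous_on S (wirtinger_bar f)"

definition C2_on :: "complex set \<Rightarrow> (complex \<Rightarrow> complex) \<Rightarrow> bool" where
  "C2_on S f \<longleftrightarrow> f differentiable_on S \<and>
     C1_on S (wirtinger f) \<and> C1_on S (wirtinger_bar f)"

definition harmonic_mapping :: "(complex \<Rightarrow> complex) \<Rightarrow> bool" where
  "harmonic_mapping f \<longleftrightarrow> C2_on unit_disk f \<and>
     (\<forall>z\<in>unit_disk. wirtinger_bar (wirtinger f) z = 0)"

definition canonical_decomposition ::
  "(complex \<Rightarrow> complex) \<Rightarrow> (complex \<Rightarrow> complex) \<Rightarrow> (complex \<Rightarrow> complex) \<Rightarrow> bool" where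
  "canonical_decomposition f h g \<longleftrightarrow>
     h holomorphic_on unit_disk \<and> g holomorphic_on unit_disk \<and> g 0 = 0 \<and>
     (\<forall>z\<in>unit_disk. f z = h z + cnj (g z))"

text \<open>By the next lemma, the existential quantifiers in the definitions of the two classes below
  range over a single pair, up to values outside the disk.\<close>

lemma canonical_decomposition_unique:
  assumes "canonical_decomposition f h1 g1" "canonical_decomposition f h2 g2"
    and z: "z \<in> unit_disk"
  shows "h1 z = h2 z" "g1 z = g2 z"
proof -
  define F where "F = (\<lambda>z. h1 z - h2 z)"
  define G where "G = (\<lambda>z. g2 z - g1 z)"
  have hol: "F holomorphic_on unit_disk" "G holomorphic_on unit_disk"
    using assms unfolding canonical_decomposition_def F_def G_def
    by (auto intro!: holomorphic_intros)
  have eq: "F w = cnj (G w)" if "w \<in> unit_disk" for w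
  proof -
    have "h1 w + cnj (g1 w) = h2 w + cnj (g2 w)"
      using assms that unfolding canonical_decomposition_def by metis
    then show ?thesis
      by (simp add: F_def G_def algebra_simps)
  qed
  have G0: "deriv G w = 0" if w: "w \<in> unit_disk" for w
  proof -
    have dF: "(F has_derivative (*) (deriv F w)) (at w)"
      using holomorphic_derivI[OF hol(1) open_ball w]
      by (simp add: has_field_derivative_def)
    have "(G has_derivative (*) (deriv G w)) (at w)"
      using holomorphic_derivI[OF hol(2) open_ball w]
      by (simp add: has_field_derivative_def)
    then have "((\<lambda>x. cnj (G x)) has_derivative (\<lambda>x. cnj (deriv G w * x))) (at w)"
      by (rule has_derivative_cnj)
    then have "(F has_derivative (\<lambda>x. cnj (deriv G w * x))) (at w)"
      by (rule has_derivative_transform_within_open[OF _ open_ball w]) (simp add: eq)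
    from has_derivative_unique[OF dF this]
    have *: "deriv F w * x = cnj (deriv G w * x)" for x
      by (rule fun_cong)
    from *[of 1] *[of \<i>] show ?thesis
      by (auto simp: complex_eq_iff)
  qed
  have "G constant_on unit_disk"
  proof (rule has_field_derivative_0_imp_constant_on)
    show "(G has_field_derivative 0) (at w)" if "w \<in> unit_disk" for w
      using holomorphic_derivI[OF hol(2) open_ball that] G0[OF that] by simp
  qed auto
  moreover have "G 0 = 0"
    using assms by (simp add: G_def canonical_decomposition_def)
  ultimately have "G z = 0"
    using z unfolding constant_on_def
    by (metis centre_in_ball zero_less_one)
  then show "h1 z = h2 z" "g1 z = g2 z"
    using eq[OF z] by (auto simp: F_def G_def)
qed

definition jacobian :: "(complex \<Rightarrow> complex) \<Rightarrow> (complex \<Rightarrow> complex) \<Rightarrow> complex \<Rightarrow> real" where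
  "jacobian h g z = (norm (deriv h z))\<^sup>2 - (norm (deriv g z))\<^sup>2"

definition locally_univalent :: "(complex \<Rightarrow> complex) \<Rightarrow> bool" where
  "locally_univalent f \<longleftrightarrow>
     (\<forall>z\<in>unit_disk. \<exists>U. open U \<and> z \<in> U \<and> U \<subseteq> unit_disk \<and> inj_on f U)"

definition harmonic_Bloch :: "real \<Rightarrow> (complex \<Rightarrow> complex) set" where
  "harmonic_Bloch \<nu> = {f. harmonic_mapping f \<and>
     (\<exists>h g. canonical_decomposition f h g \<and>
        bdd_above ((\<lambda>z. (1 - (norm z)\<^sup>2) powr \<nu> * (norm (deriv h z) + norm (deriv g z)))
          ` unit_disk))}"

definition harmonic_Bloch_star :: "real \<Rightarrow> (complex \<Rightarrow> complex) set" where
  "harmonic_Bloch_star \<nu> = {f. harmonic_mapping f \<and>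
     (\<exists>h g. canonical_decomposition f h g \<and>
        bdd_above ((\<lambda>z. (1 - (norm z)\<^sup>2) powr \<nu> * sqrt \<bar>jacobian h g z\<bar>) ` unit_disk))}"

end

(* Let f = h + cnj g be locally injective. For small r, the loop t \<mapsto> f (z + r cis t) - f z
   has winding number 1 or -1 according to the sign of the Jacobian at z (when nonzero), and on a convex set where f
   is injective all these loops are homotopic; so the Jacobian does not change sign and, after
   exchanging h and g, g' = \<omega> h' with |\<omega>| \<le> 1 (zeros of the Jacobian need not be excluded, so Lewy's
   theorem is not required). The Schwarz-Pick lemma bounds 1 - |\<omega>|^2 below by a multiple of 1 - |z|^2,
   which costs the exponent 1/2. Sharpness: h' = (1 - z) powr -(\<nu> + 1/2) and g' = z h'. *)
theory Submission
  imports Defs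
begin

section \<open>Winding numbers of small image circles and orientation on convex sets\<close>

lemma has_derivative_harmonic:
  assumes "open S" "h holomorphic_on S" "g holomorphic_on S"
    and "\<And>w. w \<in> S \<Longrightarrow> f w = h w + cnj (g w)" and z: "z \<in> S"
  shows "(f has_derivative (\<lambda>x. deriv h z * x + cnj (deriv g z * x))) (at z)"
proof -
  have "(h has_derivative (*) (deriv h z)) (at z)" "(g has_derivative (*) (deriv g z)) (at z)"
    using holomorphic_derivI[OF assms(2,1) z] holomorphic_derivI[OF assms(3,1) z]
    by (simp_all add: has_field_derivative_def)
  then have "((\<lambda>w. h w + cnj (g w)) has_derivative
      (\<lambda>x. deriv h z * x + cnj (deriv g z * x))) (at z)"
    by (intro has_derivative_add has_derivative_cnj)
  then show ?thesis
    by (rule has_derivative_transform_within_open[OF _ assms(1) z]) (simp add: assms(4))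
qed

text \<open>Subtracting \<open>f z\<close> turns winding about \<open>f z\<close> into winding about
  0, so loops with different centres can be compared in the single space \<open>- {0}\<close>. The
  parameter \<open>t\<close> runs over [0,1], as for library paths.\<close>

definition circle_increment :: "(complex \<Rightarrow> complex) \<Rightarrow> complex \<Rightarrow> real \<Rightarrow> real \<Rightarrow> complex" where
  "circle_increment f z r t = f (z + of_real r * cis (2 * pi * t)) - f z"

lemma winding_number_scaled_cis:
  assumes "a \<noteq> 0"
  shows "winding_number (\<lambda>t. a * cis (2 * pi * t)) 0 = 1"
proof -
  let ?\<gamma> = "\<lambda>t. a * cis (2 * pi * t)"
  have vd: "(?\<gamma> has_vector_derivative (2 * pi * \<i> * ?\<gamma> t)) (at t within T)" for t T
    unfolding cis_conv_exp
    by (rule has_vector_derivative_real_field derivative_eq_intros refl | simp)+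
  have "valid_path ?\<gamma>"
    unfolding valid_path_def
    by (rule C1_differentiable_imp_piecewise)
      (auto simp: C1_differentiable_on_def intro!: exI[of _ "\<lambda>t. 2 * pi * \<i> * ?\<gamma> t"] vd continuous_intros)
  moreover have "((\<lambda>w. 1 / (w - 0)) has_contour_integral (2 * pi * \<i>)) ?\<gamma>"
  proof -
    \<comment> \<open>The derivative of \<open>?\<gamma>\<close> divided by \<open>?\<gamma>\<close>
      is this constant, so it is the integrand of the contour integral.\<close>
    have "((\<lambda>t. 2 * pi * \<i>) has_integral (2 * pi * \<i>)) {0..1::real}"
      using has_integral_const_real[of "2 * pi * \<i>" 0 1] by simp
    then show ?thesis
      unfolding has_contour_integral_def
      by (rule has_integral_eq[rotated])
        (use assms in \<open>simp add: vector_derivative_within_closed_interval[OF _ _ vd]\<close>)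
  qed
  moreover have "0 \<notin> path_image ?\<gamma>"
    using assms by (auto simp: path_image_def)
  ultimately show ?thesis
    by (simp add: winding_number_valid_path contour_integral_unique)
qed

lemma path_circle_increment:
  assumes "continuous_on (cball z r) f" "r \<ge> 0"
  shows "path (circle_increment f z r)"
  unfolding path_def circle_increment_def
  by (intro continuous_intros continuous_on_compose2[OF assms(1)]) (use assms(2) in \<open>auto simp: dist_norm norm_mult\<close>)

lemma loop_circle_increment: "pathfinish (circle_increment f z r) = pathstart (circle_increment f z r)"
  by (simp add: pathfinish_def pathstart_def circle_increment_def)

text \<open>The linear part \<open>A * x + cnj (B * x)\<close> stays within
  \<open>norm B * r\<close> of \<open>A * x\<close>, whose modulus is \<open>norm A * r\<close>. For
  small \<open>r\<close> the differentiability error does not use up the gap, so the loop is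
  homotopic off 0 to the circle traced by \<open>A * x\<close>.\<close>

lemma winding_number_circle_increment:
  assumes cont: "continuous_on (ball z R) f" "R > 0"
    and der: "(f has_derivative (\<lambda>x. A * x + cnj (B * x))) (at z)"
    and less: "norm B < norm A"
  shows "\<forall>\<^sub>F r in at_right 0. winding_number (circle_increment f z r) 0 = 1"
proof -
  \<comment> \<open>Half the gap: \<open>e * r + norm B * r\<close> then stays below
    \<open>norm A * r\<close>.\<close>
  define e where "e = (norm A - norm B) / 2"
  have e: "e > 0" using less by (simp add: e_def)
  from der e obtain d where d: "d > 0"
    and "\<And>y. norm (y - z) < d \<Longrightarrow> norm (f y - f z - (A * (y - z) + cnj (B * (y - z)))) \<le> e * norm (y - z)"
    unfolding has_derivative_at_alt by meson
  then have est: "norm (f (z + x) - f z - (A * x + cnj (B * x))) \<le> e * norm x" if "norm x < d" for x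
    using that by (metis add_diff_cancel_left')
  show ?thesis
    unfolding eventually_at_right_field
  proof (intro exI conjI allI impI)
    show "min d R > 0" using d assms by simp
    fix r :: real assume r: "0 < r" "r < min d R"
    let ?\<gamma> = "\<lambda>t. (r * A) * cis (2 * pi * t)"
    have "homotopic_loops (- {0}) ?\<gamma> (circle_increment f z r)"
    proof (rule homotopic_loops_nearby_explicit)
      show "path (circle_increment f z r)"
        using r by (intro path_circle_increment continuous_on_subset[OF cont(1)]) auto
      show "path ?\<gamma>" by (auto simp: path_def intro!: continuous_intros)
      \<comment> \<open>The only point outside \<open>- {0}\<close> is 0, so the goal says that the
        loops are closer to each other than \<open>?\<gamma> t\<close> is to 0.\<close>
      fix t x assume "x \<notin> - {0::complex}"
      let ?x = "r * cis (2 * pi * t)"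
      have nx: "norm ?x = r" using r by (simp add: norm_mult)
      have "circle_increment f z r t - ?\<gamma> t = (f (z + ?x) - f z - (A * ?x + cnj (B * ?x))) + cnj (B * ?x)"
        by (simp add: circle_increment_def algebra_simps)
      also have "norm \<dots> \<le> e * r + norm B * r"
        using est[of ?x] nx r by (intro norm_triangle_mono) (auto simp: norm_mult)
      also have "\<dots> < norm A * r"
        using less r e by (simp add: e_def field_simps)
      also have "\<dots> = norm (?\<gamma> t - x)"
        using r \<open>x \<notin> - {0}\<close> by (simp add: norm_mult)
      finally show "norm (circle_increment f z r t - ?\<gamma> t) < norm (?\<gamma> t - x)" .
    qed (simp_all add: loop_circle_increment, simp add: pathstart_def pathfinish_def)
    then have "winding_number (circle_increment f z r) 0 = winding_number ?\<gamma> 0"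
      by (simp add: winding_number_homotopic_loops)
    also have "\<dots> = 1"
      using less r by (intro winding_number_scaled_cis) auto
    finally show "winding_number (circle_increment f z r) 0 = 1" .
  qed
qed

text \<open>Centre and radius move linearly at once from (\<open>a\<close>, \<open>r\<close>) to
  (\<open>b\<close>, \<open>s\<close>). By convexity the moving circle and its centre stay in
  \<open>S\<close>, and since the circle misses its centre, injectivity keeps the difference of
  values off 0.\<close>

lemma circle_increment_homotopic:
  assumes "convex S" "continuous_on S f" "inj_on f S"
    and "cball a r \<subseteq> S" "cball b s \<subseteq> S" "r > 0" "s > 0"
  shows "homotopic_loops (- {0}) (circle_increment f a r) (circle_increment f b s)"
proof -
  define c where "c = (\<lambda>u::real. (1 - u) *\<^sub>R a + u *\<^sub>R b)"
  define \<rho> where "\<rho> = (\<lambda>u::real. (1 - u) * r + u * s)"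
  define p where "p = (\<lambda>(u::real, t::real). c u + of_real (\<rho> u) * cis (2 * pi * t))"
  have p_in: "p (u, t) \<in> S" if "u \<in> {0..1}" for u t
  proof -
    \<comment> \<open>Each point of the moving circle is a convex combination of the points at the
      same angle on the two given circles.\<close>
    have "p (u, t) = (1 - u) *\<^sub>R (a + r * cis (2 * pi * t)) + u *\<^sub>R (b + s * cis (2 * pi * t))"
      by (simp add: p_def c_def \<rho>_def scaleR_conv_of_real algebra_simps)
    moreover have "a + r * cis (2 * pi * t) \<in> S" "b + s * cis (2 * pi * t) \<in> S"
      using assms(4-7) by (auto simp: subset_iff dist_norm norm_mult)
    ultimately show ?thesis
      using that \<open>convex S\<close> by (auto intro!: convexD)
  qed
  have c_in: "c u \<in> S" if "u \<in> {0..1}" for u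
    unfolding c_def using that assms(1,4-7) by (intro convexD) auto
  have "f (p (u, t)) \<noteq> f (c u)" if u: "u \<in> {0..1}" for u t
  proof
    assume "f (p (u, t)) = f (c u)"
    then have "p (u, t) = c u"
      using assms(3) p_in c_in u by (auto dest: inj_onD)
    moreover have "\<rho> u > 0"
      using u assms(6,7) by (cases "u = 0") (auto simp: \<rho>_def intro!: add_nonneg_pos)
    ultimately show False by (simp add: p_def)
  qed
  moreover have "continuous_on ({0..1} \<times> {0..1}) (\<lambda>x. f (p x) - f (c (fst x)))"
    by (intro continuous_intros continuous_on_compose2[OF assms(2)])
      (auto simp: p_in c_in, auto simp: p_def c_def \<rho>_def case_prod_unfold intro!: continuous_intros)
  ultimately show ?thesis
    unfolding homotopic_loops
    by (intro exI[of _ "\<lambda>x. f (p x) - f (c (fst x))"])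
      (auto simp: pathfinish_def pathstart_def p_def c_def \<rho>_def circle_increment_def)
qed

text \<open>A negative Jacobian at \<open>b\<close> would make \<open>cnj \<circ> f\<close>
  positively oriented there, giving winding number -1 for \<open>f\<close> around \<open>b\<close>
  against 1 around \<open>a\<close>, although these loops are homotopic. Only
  \<open>norm C < norm D\<close> is excluded in this way, hence the non-strict conclusion.\<close>

lemma orientation_on_convex:
  assumes S: "convex S" "open S" and cont: "continuous_on S f" and inj: "inj_on f S"
    and a: "a \<in> S" "(f has_derivative (\<lambda>x. A * x + cnj (B * x))) (at a)"
    and b: "b \<in> S" "(f has_derivative (\<lambda>x. C * x + cnj (D * x))) (at b)"
    and less: "norm B < norm A"
  shows "norm D \<le> norm C"
proof (rule ccontr)
  assume "\<not> norm D \<le> norm C"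
  then have CD: "norm C < norm D" by simp
  have radius: "\<exists>r>0. cball z r \<subseteq> S \<and> winding_number (circle_increment F z r) 0 = 1"
    if z: "z \<in> S" and F: "continuous_on S F" "(F has_derivative (\<lambda>x. K * x + cnj (L * x))) (at z)"
      "norm L < norm K" for z F K L
  proof -
    obtain R where R: "R > 0" "ball z R \<subseteq> S"
      using S(2) z open_contains_ball by blast
    have "\<forall>\<^sub>F r in at_right 0. winding_number (circle_increment F z r) 0 = 1"
      using R F by (intro winding_number_circle_increment continuous_on_subset[OF F(1)]) auto
    moreover have "\<forall>\<^sub>F r in at_right 0. 0 < r \<and> r < R"
      using R(1) eventually_at_right_real[of 0 R] by simp
    ultimately have "\<forall>\<^sub>F r in at_right 0. winding_number (circle_increment F z r) 0 = 1 \<and> 0 < r \<and> r < R"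
      by eventually_elim auto
    then obtain r where "winding_number (circle_increment F z r) 0 = 1" "0 < r" "r < R"
      using eventually_happens'[of "at_right (0::real)"] by auto
    then show ?thesis
      using R(2) by (intro exI[of _ r]) (auto simp: subset_iff)
  qed
  obtain r where r: "r > 0" "cball a r \<subseteq> S" "winding_number (circle_increment f a r) 0 = 1"
    using radius[OF a(1) cont a(2) less] by auto
  \<comment> \<open>Conjugation swaps the roles of \<open>C\<close> and \<open>D\<close>, so
    \<open>radius\<close> applies at \<open>b\<close> with \<open>D\<close> dominant.\<close>
  have "((\<lambda>x. cnj (f x)) has_derivative (\<lambda>x. cnj (C * x + cnj (D * x)))) (at b)"
    by (intro has_derivative_cnj b(2))
  then have "((cnj \<circ> f) has_derivative (\<lambda>x. D * x + cnj (C * x))) (at b)"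
    by (simp add: o_def add.commute)
  then obtain s where s: "s > 0" "cball b s \<subseteq> S"
      "winding_number (circle_increment (cnj \<circ> f) b s) 0 = 1"
    using radius[OF b(1) _ _ CD, of "cnj \<circ> f"] cont
    by (auto simp: o_def intro: continuous_intros)
  have hom: "homotopic_loops (- {0}) (circle_increment f a r) (circle_increment f b s)"
    using circle_increment_homotopic[OF S(1) cont inj r(2) s(2) r(1) s(1)] .
  have "circle_increment (cnj \<circ> f) b s = cnj \<circ> circle_increment f b s"
    by (auto simp: circle_increment_def)
  moreover have "path (circle_increment f b s)" "0 \<notin> path_image (circle_increment f b s)"
    using homotopic_loops_imp_path[OF hom] homotopic_loops_imp_subset[OF hom] by auto
  \<comment> \<open>Conjugating a loop around 0 turns its winding number \<open>n\<close> into
    \<open>- cnj n\<close>.\<close>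
  ultimately have "- cnj (winding_number (circle_increment f b s) 0) = 1"
    using s(3) winding_number_cnj[of "circle_increment f b s" 0] by simp
  then have "- cnj 1 = (1 :: complex)"
    using winding_number_homotopic_loops[OF hom] r(3) by simp
  then show False by simp
qed

section \<open>Bounded quotients of holomorphic functions and the Schwarz-Pick bound\<close>

text \<open>The zeros of \<open>p\<close> are isolated because \<open>p z0 \<noteq> 0\<close> and
  \<open>S\<close> is connected, and \<open>q / p\<close> is bounded by 1 off them. The
  singularities are therefore removable, and \<open>\<omega>\<close> is the quotient with these
  filled in.\<close>

lemma dominated_holomorphic_factor:
  assumes S: "open S" "connected S" and hol: "p holomorphic_on S" "q holomorphic_on S"
    and le: "\<And>z. z \<in> S \<Longrightarrow> norm (q z) \<le> norm (p z)"
    and nz: "z0 \<in> S" "p z0 \<noteq> 0"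
  obtains \<omega> where "\<omega> holomorphic_on S" "\<And>z. z \<in> S \<Longrightarrow> q z = \<omega> z * p z"
    "\<And>z. z \<in> S \<Longrightarrow> norm (\<omega> z) \<le> 1"
proof -
  define \<omega> where "\<omega> = remove_sings (\<lambda>z. q z / p z)"
  have "\<omega> analytic_on {z} \<and> q z = \<omega> z * p z \<and> norm (\<omega> z) \<le> 1" if z: "z \<in> S" for z
  proof -
    obtain r where r: "r > 0" "ball z r \<subseteq> S" "\<And>w. w \<in> ball z r - {z} \<Longrightarrow> p w \<noteq> 0"
    proof (cases "p z = 0")
      case True
      with isolated_zeros[OF hol(1) S z True nz] that show ?thesis by metis
    next
      case False
      have "continuous (at z) p"
        using hol(1) S(1) z holomorphic_on_imp_continuous_on continuous_on_eq_continuous_at by blast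
      from continuous_at_avoid[OF this False] obtain e where e: "e > 0" "\<forall>y. dist z y < e \<longrightarrow> p y \<noteq> 0"
        by blast
      obtain e' where "e' > 0" "ball z e' \<subseteq> S"
        using S(1) z open_contains_ball by blast
      with e show ?thesis by (intro that[of "min e e'"]) auto
    qed
    let ?f = "\<lambda>z. q z / p z"
    have holf: "?f holomorphic_on ball z r - {z}"
      using r by (intro holomorphic_intros holomorphic_on_subset[OF hol(1)] holomorphic_on_subset[OF hol(2)]) auto
    have ev: "\<forall>\<^sub>F w in at z. w \<in> ball z r - {z}"
      using r(1) eventually_at_in_open[of "ball z r" z] by simp
    have bd: "\<forall>\<^sub>F w in at z. norm (?f w) \<le> 1"
      using ev by eventually_elim (use r le in \<open>auto simp: norm_divide divide_le_eq_1\<close>)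
    then have "\<exists>g. g holomorphic_on ball z r \<and> (\<forall>w \<in> ball z r - {z}. g w = ?f w)"
      using holomorphic_on_extend_bounded[OF holf] r(1) by auto
    then obtain g where g: "g holomorphic_on ball z r" "\<And>w. w \<in> ball z r - {z} \<Longrightarrow> g w = ?f w"
      by blast
    have cont: "F \<midarrow>z\<rightarrow> F z" if "F holomorphic_on ball z r" for F
      using that r(1) holomorphic_on_imp_continuous_on continuous_on_eq_continuous_at
      by (metis centre_in_ball continuous_at open_ball isCont_def)
    have gf: "\<forall>\<^sub>F w in at z. g w = ?f w"
      using ev by eventually_elim (use g in auto)
    have lim: "?f \<midarrow>z\<rightarrow> g z"
      using cont[OF g(1)] tendsto_cong[OF gf] by simp
    then have w: "\<omega> z = g z"
      unfolding \<omega>_def by (rule remove_sings_eqI)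
    have "isolated_singularity_at ?f z"
      using isolated_singularity_at_holomorphic[OF holf] r(1) by simp
    then have "\<omega> analytic_on {z}"
      unfolding \<omega>_def using lim by (rule remove_sings_analytic_at)
    moreover have "norm (g z) \<le> 1"
      using tendsto_upperbound[OF tendsto_norm[OF lim] bd] by simp
    \<comment> \<open>Both sides of the factorization are continuous at \<open>z\<close> and agree
      near it, so they agree at \<open>z\<close> even if \<open>p z = 0\<close>.\<close>
    moreover have "(\<lambda>w. g w * p w) \<midarrow>z\<rightarrow> g z * p z" "q \<midarrow>z\<rightarrow> q z"
      using cont g(1) hol r(2) by (auto intro!: tendsto_mult intro: holomorphic_on_subset)
    moreover have "\<forall>\<^sub>F w in at z. g w * p w = q w"
      using ev by eventually_elim (use g r in auto)
    ultimately show ?thesis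
      using w tendsto_cong[of "\<lambda>w. g w * p w" q "at z" "g z * p z"]
        tendsto_unique[of "at z" q "g z * p z" "q z"] by simp
  qed
  then have "\<omega> analytic_on S" "\<And>z. z \<in> S \<Longrightarrow> q z = \<omega> z * p z" "\<And>z. z \<in> S \<Longrightarrow> norm (\<omega> z) \<le> 1"
    using analytic_on_analytic_at by blast+
  then show ?thesis
    using that analytic_imp_holomorphic by blast
qed

text \<open>The Schwarz lemma, applied to \<open>\<omega>\<close> followed by the disc automorphism
  taking \<open>a = \<omega> 0\<close> to 0, bounds \<open>norm (w - a)\<close> by
  \<open>norm z * norm (1 - cnj a * w)\<close> for \<open>w = \<omega> z\<close>. The constant comes
  from \<open>1 - norm a \<le> norm (1 - cnj a * w)\<close>.\<close>

lemma Schwarz_Pick_lower_bound: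
  assumes hol: "\<omega> holomorphic_on ball 0 1" and lt: "\<And>z. norm z < 1 \<Longrightarrow> norm (\<omega> z) < 1"
    and z: "norm z < 1"
  shows "(1 - norm (\<omega> 0))\<^sup>2 * (1 - (norm z)\<^sup>2) \<le> 1 - (norm (\<omega> z))\<^sup>2"
proof -
  define a w where "a = \<omega> 0" and "w = \<omega> z"
  have a: "norm a < 1" and w: "norm w < 1" using lt z by (auto simp: a_def w_def)
  define \<phi> where "\<phi> = Moebius_function 0 a \<circ> \<omega>"
  have "\<phi> holomorphic_on ball 0 1"
    unfolding \<phi>_def
    by (rule holomorphic_on_compose_gen[OF hol Moebius_function_holomorphic[OF a]]) (use lt in auto)
  moreover have "\<phi> 0 = 0" by (simp add: \<phi>_def a_def Moebius_function_def)
  moreover have "norm (\<phi> z) < 1" if "norm z < 1" for z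
    using Moebius_function_norm_lt_1[OF a lt[OF that]] by (simp add: \<phi>_def)
  ultimately have "norm (\<phi> z) \<le> norm z"
    using z by (rule Schwarz_Lemma(1))
  moreover have nz: "1 - cnj a * w \<noteq> 0"
    using mult_strict_mono'[OF a w] by (metis complex_mod_cnj eq_iff_diff_eq_0 less_irrefl mult_1 norm_ge_zero norm_mult norm_one)
  ultimately have "norm (w - a) \<le> norm z * norm (1 - cnj a * w)"
    using nz by (simp add: \<phi>_def Moebius_function_def w_def norm_divide pos_divide_le_eq)
  then have "(norm (w - a))\<^sup>2 \<le> (norm z)\<^sup>2 * (norm (1 - cnj a * w))\<^sup>2"
    by (metis norm_ge_zero power_mono power_mult_distrib)
  \<comment> \<open>This identity converts the bound on \<open>norm (w - a)\<close> into one on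
    \<open>1 - (norm w)\<^sup>2\<close>.\<close>
  moreover have "(norm (1 - cnj a * w))\<^sup>2 - (norm (w - a))\<^sup>2 = (1 - (norm a)\<^sup>2) * (1 - (norm w)\<^sup>2)"
    unfolding cmod_power2 by (simp add: power2_eq_square algebra_simps)
  ultimately have 1: "(1 - (norm z)\<^sup>2) * (norm (1 - cnj a * w))\<^sup>2 \<le> (1 - (norm a)\<^sup>2) * (1 - (norm w)\<^sup>2)"
    by (simp add: algebra_simps)
  have "norm a * norm w \<le> norm a" using w by (simp add: mult_left_le)
  then have "1 - norm a \<le> norm (1 - cnj a * w)"
    using norm_triangle_ineq2[of 1 "cnj a * w"] by (simp add: norm_mult)
  then have "(1 - norm a)\<^sup>2 \<le> (norm (1 - cnj a * w))\<^sup>2"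
    using a by (intro power_mono) auto
  then have "(1 - norm a)\<^sup>2 * (1 - (norm z)\<^sup>2) \<le> (1 - (norm z)\<^sup>2) * (norm (1 - cnj a * w))\<^sup>2"
    using z by (simp add: mult.commute mult_left_mono power_le_one abs_square_le_1)
  also note 1
  also have "(1 - (norm a)\<^sup>2) * (1 - (norm w)\<^sup>2) \<le> 1 * (1 - (norm w)\<^sup>2)"
    using w by (intro mult_right_mono) (auto simp: power_le_one)
  finally show ?thesis by (simp add: a_def w_def)
qed

text \<open>Writing \<open>q = \<omega> * p\<close> turns the difference of squares into
  \<open>(1 - (norm (\<omega> z))\<^sup>2) * (norm (p z))\<^sup>2\<close>, and the Schwarz-Pick
  bound applies, with \<open>k\<close> the square of \<open>1 - norm (\<omega> 0)\<close>.\<close>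

lemma dominated_square_difference:
  assumes hol: "p holomorphic_on ball 0 1" "q holomorphic_on ball 0 1"
    and le: "\<And>z. z \<in> ball 0 1 \<Longrightarrow> norm (q z) \<le> norm (p z)"
    and strict: "z0 \<in> ball 0 1" "norm (q z0) \<noteq> norm (p z0)"
  obtains k where "k > 0"
    "\<And>z. z \<in> ball 0 1 \<Longrightarrow> k * (1 - (norm z)\<^sup>2) * (norm (p z))\<^sup>2 \<le> (norm (p z))\<^sup>2 - (norm (q z))\<^sup>2"
proof -
  have "p z0 \<noteq> 0" using le[OF strict(1)] strict(2) by auto
  from dominated_holomorphic_factor[OF open_ball connected_ball hol le strict(1) this]
  obtain \<omega> where \<omega>: "\<omega> holomorphic_on ball 0 1" "\<And>z. z \<in> ball 0 1 \<Longrightarrow> q z = \<omega> z * p z"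
    "\<And>z. z \<in> ball 0 1 \<Longrightarrow> norm (\<omega> z) \<le> 1" by metis
  \<comment> \<open>A point with \<open>norm (\<omega> z) = 1\<close> would be an interior maximum,
    so \<open>\<omega>\<close> would be a unimodular constant, against
    \<open>strict\<close>.\<close>
  have lt: "norm (\<omega> z) < 1" if z: "z \<in> ball 0 1" for z
  proof (rule ccontr)
    assume "\<not> norm (\<omega> z) < 1"
    then have z1: "norm (\<omega> z) = 1" using \<omega>(3)[OF z] by simp
    then have "\<omega> constant_on ball 0 1"
      using \<omega>(3) z
      by (intro maximum_modulus_principle[OF \<omega>(1) open_ball connected_ball open_ball order_refl z]) auto
    then have "norm (\<omega> z0) = 1" using z z1 strict(1) unfolding constant_on_def by metis
    then show False using \<omega>(2)[OF strict(1)] strict(2) by (simp add: norm_mult)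
  qed
  show ?thesis
  proof
    show "(1 - norm (\<omega> 0))\<^sup>2 > 0" using lt[of 0] by simp
    fix z :: complex assume z: "z \<in> ball 0 1"
    have "(1 - norm (\<omega> 0))\<^sup>2 * (1 - (norm z)\<^sup>2) * (norm (p z))\<^sup>2 \<le> (1 - (norm (\<omega> z))\<^sup>2) * (norm (p z))\<^sup>2"
      by (intro mult_right_mono Schwarz_Pick_lower_bound[OF \<omega>(1)]) (use lt z in auto)
    then show "(1 - norm (\<omega> 0))\<^sup>2 * (1 - (norm z)\<^sup>2) * (norm (p z))\<^sup>2 \<le> (norm (p z))\<^sup>2 - (norm (q z))\<^sup>2"
      using \<omega>(2)[OF z] by (simp add: norm_mult power_mult_distrib algebra_simps)
  qed
qed

section \<open>Degenerate mappings and the global choice of orientation\<close>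

text \<open>Equal moduli force \<open>deriv g z = \<alpha> * deriv h z\<close> with a unimodular
  constant \<open>\<alpha>\<close>, so the values of the mapping lie on a line. By invariance of
  domain an injective continuous map on \<open>S\<close> has an open image, which no line
  contains.\<close>

lemma not_inj_on_degenerate:
  assumes S: "open S" "connected S" "S \<noteq> {}"
    and hol: "h holomorphic_on S" "g holomorphic_on S"
    and eq: "\<And>z. z \<in> S \<Longrightarrow> norm (deriv h z) = norm (deriv g z)"
  shows "\<not> inj_on (\<lambda>z. h z + cnj (g z)) S"
proof
  let ?f = "\<lambda>z. h z + cnj (g z)"
  assume inj: "inj_on ?f S"
  have dhol: "deriv h holomorphic_on S" "deriv g holomorphic_on S"
    using holomorphic_deriv hol S(1) by blast+
  \<comment> \<open>If \<open>deriv h\<close> vanishes on \<open>S\<close>, so does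
    \<open>deriv g\<close>, and 1 serves. Otherwise the quotient \<open>\<omega>\<close> has modulus
    1 at \<open>z0\<close> and at most 1 elsewhere, so the maximum modulus principle makes it
    constant.\<close>
  obtain \<alpha> where \<alpha>: "norm \<alpha> = 1" "\<And>z. z \<in> S \<Longrightarrow> deriv g z = \<alpha> * deriv h z"
  proof (cases "\<exists>z\<in>S. deriv h z \<noteq> 0")
    case False
    then have "deriv g z = 1 * deriv h z" if "z \<in> S" for z
      using eq[OF that] that by simp
    then show ?thesis using that[of 1] by simp
  next
    case True
    then obtain z0 where z0: "z0 \<in> S" "deriv h z0 \<noteq> 0" by blast
    from dominated_holomorphic_factor[OF S(1,2) dhol _ z0] eq
    obtain \<omega> where \<omega>: "\<omega> holomorphic_on S" "\<And>z. z \<in> S \<Longrightarrow> deriv g z = \<omega> z * deriv h z"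
      "\<And>z. z \<in> S \<Longrightarrow> norm (\<omega> z) \<le> 1" by (metis order_refl)
    have 1: "norm (\<omega> z0) = 1"
      using eq[OF z0(1)] z0 \<omega>(2)[OF z0(1)] by (simp add: norm_mult)
    have "\<omega> constant_on S"
      using \<omega>(3) 1 by (intro maximum_modulus_principle[OF \<omega>(1) S(1,2) S(1) order_refl z0(1)]) auto
    then have "\<omega> z = \<omega> z0" if "z \<in> S" for z
      using that z0(1) unfolding constant_on_def by metis
    then show ?thesis using that[of "\<omega> z0"] 1 \<omega>(2) by metis
  qed
  have "(\<lambda>z. g z - \<alpha> * h z) constant_on S"
  proof (rule has_field_derivative_0_imp_constant_on)
    fix z assume z: "z \<in> S"
    show "((\<lambda>z. g z - \<alpha> * h z) has_field_derivative 0) (at z)"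
      using \<alpha>(2)[OF z] holomorphic_derivI[OF hol(1) S(1) z] holomorphic_derivI[OF hol(2) S(1) z]
      by (auto intro!: derivative_eq_intros)
  qed (use S in auto)
  then obtain c where "\<And>z. z \<in> S \<Longrightarrow> g z - \<alpha> * h z = c"
    unfolding constant_on_def by blast
  then have c: "g z = \<alpha> * h z + c" if "z \<in> S" for z
    using that by (simp add: diff_eq_eq add.commute)
  \<comment> \<open>\<open>\<beta> f\<close> has constant imaginary part, so \<open>f\<close> maps \<open>S\<close> into a line.\<close>
  define \<beta> where "\<beta> = csqrt \<alpha>"
  have \<beta>: "\<beta>\<^sup>2 = \<alpha>" by (simp add: \<beta>_def)
  have n\<beta>: "norm \<beta> = 1" by (simp add: \<beta>_def norm_csqrt \<alpha>(1))
  then have \<beta>': "\<beta> * cnj \<beta> = 1" by (simp add: complex_norm_square[symmetric])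
  \<comment> \<open>The real inner product with \<open>\<i> * cnj \<beta>\<close> is the imaginary
    part of the product with \<open>\<beta>\<close>; this form presents the line as a
    hyperplane.\<close>
  have "(\<i> * cnj \<beta>) \<bullet> ?f z = Im (\<beta> * cnj c)" if "z \<in> S" for z
  proof -
    have "\<beta> * ?f z = \<beta> * h z + (\<beta> * cnj \<beta>) * (cnj \<beta> * cnj (h z)) + \<beta> * cnj c"
      using c[OF that] by (simp add: \<beta>[symmetric] power2_eq_square algebra_simps)
    also have "\<dots> = \<beta> * h z + cnj (\<beta> * h z) + \<beta> * cnj c" by (simp add: \<beta>')
    finally have "Im (\<beta> * ?f z) = Im (\<beta> * cnj c)" by simp
    then show ?thesis by (simp add: inner_complex_def algebra_simps)
  qed
  then have "?f ` S \<subseteq> {w. (\<i> * cnj \<beta>) \<bullet> w = Im (\<beta> * cnj c)}" by auto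
  moreover have "open (?f ` S)"
    by (intro invariance_of_domain inj S continuous_intros holomorphic_on_imp_continuous_on hol)
  ultimately have "?f ` S \<subseteq> interior {w. (\<i> * cnj \<beta>) \<bullet> w = Im (\<beta> * cnj c)}"
    by (rule interior_maximal)
  moreover have "interior {w. (\<i> * cnj \<beta>) \<bullet> w = Im (\<beta> * cnj c)} = {}"
    using n\<beta> by (intro interior_hyperplane) auto
  ultimately show False using S(3) by blast
qed

text \<open>On a disc where \<open>f\<close> is injective the Jacobian keeps a weak sign, so every
  point is interior to \<open>A\<close> or to \<open>B\<close>, the sets of the two weak signs.
  Their interiors are disjoint, as otherwise the Jacobian would vanish on a nonempty open set;
  connectedness of \<open>S\<close> then leaves only one.\<close>

lemma locally_injective_harmonic_orientation:
  assumes S: "open S" "connected S" "S \<noteq> {}"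
    and hol: "h holomorphic_on S" "g holomorphic_on S"
    and f: "\<And>z. z \<in> S \<Longrightarrow> f z = h z + cnj (g z)"
    and inj: "\<And>z. z \<in> S \<Longrightarrow> \<exists>U. open U \<and> z \<in> U \<and> U \<subseteq> S \<and> inj_on f U"
  shows "(\<forall>z\<in>S. norm (deriv g z) \<le> norm (deriv h z)) \<or> (\<forall>z\<in>S. norm (deriv h z) \<le> norm (deriv g z))"
    and "\<exists>z\<in>S. norm (deriv g z) \<noteq> norm (deriv h z)"
proof -
  \<comment> \<open>A Jacobian vanishing on a nonempty open set contradicts local injectivity there;
    both conclusions rest on this.\<close>
  have degenerate: False
    if V: "open V" "V \<noteq> {}" "V \<subseteq> S" "\<And>z. z \<in> V \<Longrightarrow> norm (deriv g z) = norm (deriv h z)" for V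
  proof -
    obtain z where z: "z \<in> V" using V(2) by blast
    then obtain U where U: "open U" "z \<in> U" "U \<subseteq> S" "inj_on f U" using inj V(3) by blast
    then obtain r where r: "r > 0" "ball z r \<subseteq> U \<inter> V"
      using V(1) z open_contains_ball by (metis IntI open_Int)
    have "inj_on (\<lambda>z. h z + cnj (g z)) (ball z r)"
      using r U by (subst inj_on_cong[of _ _ f]) (auto simp: f subset_iff intro: inj_on_subset)
    moreover have "\<not> inj_on (\<lambda>z. h z + cnj (g z)) (ball z r)"
      using r V by (intro not_inj_on_degenerate holomorphic_on_subset[OF hol(1)] holomorphic_on_subset[OF hol(2)]) auto
    ultimately show False by blast
  qed
  show "\<exists>z\<in>S. norm (deriv g z) \<noteq> norm (deriv h z)"
    using degenerate[of S] S by blast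
  \<comment> \<open>\<open>A\<close> and \<open>B\<close> overlap at the zeros of the Jacobian, so
    the connectedness argument is run with their interiors.\<close>
  define A where "A = {z\<in>S. norm (deriv g z) \<le> norm (deriv h z)}"
  define B where "B = {z\<in>S. norm (deriv h z) \<le> norm (deriv g z)}"
  have "continuous_on S (\<lambda>z. h z + cnj (g z))"
    by (intro continuous_intros holomorphic_on_imp_continuous_on hol)
  then have cont: "continuous_on S f"
    by (simp add: f cong: continuous_on_cong)
  have "z \<in> interior A \<union> interior B" if z: "z \<in> S" for z
  proof -
    obtain U where U: "open U" "z \<in> U" "U \<subseteq> S" "inj_on f U" using inj z by blast
    then obtain r where r: "r > 0" "ball z r \<subseteq> U" using open_contains_ball by blast
    have rS: "ball z r \<subseteq> S" using r U by blast
    \<comment> \<open>One point of positive Jacobian puts the whole disc in \<open>A\<close>;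
      without such a point the disc lies in \<open>B\<close> at once.\<close>
    have "ball z r \<subseteq> A" if a: "a \<in> ball z r" "norm (deriv g a) < norm (deriv h a)" for a
    proof
      fix b assume b: "b \<in> ball z r"
      have "norm (deriv g b) \<le> norm (deriv h b)"
        using orientation_on_convex[OF convex_ball open_ball continuous_on_subset[OF cont rS]
            inj_on_subset[OF U(4) r(2)] a(1) has_derivative_harmonic[OF S(1) hol f]
            b has_derivative_harmonic[OF S(1) hol f] a(2)] a b rS by blast
      then show "b \<in> A" using b rS by (auto simp: A_def)
    qed
    moreover have "ball z r \<subseteq> B" if "\<And>a. a \<in> ball z r \<Longrightarrow> \<not> norm (deriv g a) < norm (deriv h a)"
      unfolding B_def using that rS by (force simp: not_less)
    ultimately have "ball z r \<subseteq> A \<or> ball z r \<subseteq> B" by blast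
    then show ?thesis using r(1) mem_interior by blast
  qed
  then have "S \<subseteq> interior A \<union> interior B" by blast
  moreover have "interior A \<inter> interior B \<inter> S = {}"
  proof (rule ccontr)
    assume *: "interior A \<inter> interior B \<inter> S \<noteq> {}"
    have "norm (deriv g z) = norm (deriv h z)" if "z \<in> interior A \<inter> interior B \<inter> S" for z
    proof -
      have "z \<in> A" "z \<in> B" using that interior_subset by blast+
      then show ?thesis by (simp add: A_def B_def)
    qed
    then show False
      by (rule degenerate[rotated 3]) (use S(1) * in auto)
  qed
  ultimately have "interior A \<inter> S = {} \<or> interior B \<inter> S = {}"
    using connectedD[OF S(2) open_interior open_interior] by metis
  then have "S \<subseteq> B \<or> S \<subseteq> A"
    using \<open>S \<subseteq> interior A \<union> interior B\<close> interior_subset[of A] interior_subset[of B] by blast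
  then show "(\<forall>z\<in>S. norm (deriv g z) \<le> norm (deriv h z)) \<or> (\<forall>z\<in>S. norm (deriv h z) \<le> norm (deriv g z))"
    by (auto simp: A_def B_def)
qed

section \<open>The growth estimate with exponent \<nu> + 1/2\<close>

text \<open>For the dominant derivative \<open>p\<close>, the Jacobian has modulus at least a
  constant times \<open>(1 - (norm z)\<^sup>2) * (norm (p z))\<^sup>2\<close>. Taking roots bounds
  \<open>norm (p z)\<close> at the price of half a power of
  \<open>1 - (norm z)\<^sup>2\<close>.\<close>

lemma locally_univalent_Bloch_star_imp_Bloch:
  assumes harm: "harmonic_mapping f" and lu: "locally_univalent f" and star: "f \<in> harmonic_Bloch_star \<nu>"
  shows "f \<in> harmonic_Bloch (\<nu> + 1 / 2)"
proof -
  from star obtain h g M where dec: "canonical_decomposition f h g"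
    and M: "\<And>z. z \<in> unit_disk \<Longrightarrow> (1 - (norm z)\<^sup>2) powr \<nu> * sqrt \<bar>jacobian h g z\<bar> \<le> M"
    unfolding harmonic_Bloch_star_def bdd_above_def by blast
  have hol: "h holomorphic_on unit_disk" "g holomorphic_on unit_disk"
    and f: "\<And>z. z \<in> unit_disk \<Longrightarrow> f z = h z + cnj (g z)"
    using dec by (auto simp: canonical_decomposition_def)
  have dhol: "deriv h holomorphic_on unit_disk" "deriv g holomorphic_on unit_disk"
    using holomorphic_deriv hol open_ball by blast+
  have inj: "\<exists>U. open U \<and> z \<in> U \<and> U \<subseteq> unit_disk \<and> inj_on f U" if "z \<in> unit_disk" for z
    using lu that by (auto simp: locally_univalent_def)
  note orient = locally_injective_harmonic_orientation[OF open_ball connected_ball _ hol f inj, simplified]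
  obtain z0 where z0: "z0 \<in> unit_disk" "norm (deriv g z0) \<noteq> norm (deriv h z0)"
    using orient(2) by auto
  \<comment> \<open>\<open>p\<close> is whichever of \<open>deriv h\<close> and
    \<open>deriv g\<close> dominates on the disc; the absolute value of the Jacobian treats both
    orientations alike.\<close>
  obtain p :: "complex \<Rightarrow> complex" where p: "\<exists>k>0. \<forall>z\<in>unit_disk. k * (1 - (norm z)\<^sup>2) * (norm (p z))\<^sup>2 \<le> \<bar>jacobian h g z\<bar>"
    "\<And>z. z \<in> unit_disk \<Longrightarrow> norm (deriv h z) + norm (deriv g z) \<le> 2 * norm (p z)"
    using orient(1)
  proof
    assume le: "\<forall>z\<in>unit_disk. norm (deriv g z) \<le> norm (deriv h z)"
    obtain k where "k > 0" "\<And>z. z \<in> ball 0 1 \<Longrightarrow> k * (1 - (norm z)\<^sup>2) * (norm (deriv h z))\<^sup>2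
        \<le> (norm (deriv h z))\<^sup>2 - (norm (deriv g z))\<^sup>2"
      using dominated_square_difference[OF dhol _ z0] le by blast
    then show ?thesis
      using le by (intro that[of "deriv h"] exI[of _ k] conjI ballI order_trans[OF _ abs_ge_self])
        (auto simp: jacobian_def)
  next
    assume le: "\<forall>z\<in>unit_disk. norm (deriv h z) \<le> norm (deriv g z)"
    obtain k where "k > 0" "\<And>z. z \<in> ball 0 1 \<Longrightarrow> k * (1 - (norm z)\<^sup>2) * (norm (deriv g z))\<^sup>2
        \<le> (norm (deriv g z))\<^sup>2 - (norm (deriv h z))\<^sup>2"
      using dominated_square_difference[OF dhol(2,1) _ z0(1)] z0(2) le by metis
    then show ?thesis
      using le by (intro that[of "deriv g"] exI[of _ k] conjI ballI order_trans[OF _ abs_ge_minus_self])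
        (auto simp: jacobian_def)
  qed
  then obtain k where k: "k > 0"
    "\<And>z. z \<in> unit_disk \<Longrightarrow> k * (1 - (norm z)\<^sup>2) * (norm (p z))\<^sup>2 \<le> \<bar>jacobian h g z\<bar>" by blast
  have "(1 - (norm z)\<^sup>2) powr (\<nu> + 1 / 2) * (norm (deriv h z) + norm (deriv g z)) \<le> 2 * M / sqrt k"
    if z: "z \<in> unit_disk" for z
  proof -
    define s where "s = 1 - (norm z)\<^sup>2"
    have s: "s > 0" using z by (simp add: s_def abs_square_less_1)
    \<comment> \<open>The additional exponent 1/2 moves under the root, where the lower bound for
      the Jacobian applies.\<close>
    have "sqrt k * (s powr (\<nu> + 1 / 2) * norm (p z)) = s powr \<nu> * sqrt (k * s * (norm (p z))\<^sup>2)"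
      using s by (simp add: powr_add powr_half_sqrt real_sqrt_mult)
    also have "\<dots> \<le> s powr \<nu> * sqrt \<bar>jacobian h g z\<bar>"
      using k(2)[OF z] by (intro mult_left_mono) (auto simp: s_def)
    also have "\<dots> \<le> M" using M[OF z] by (simp add: s_def)
    finally have "s powr (\<nu> + 1 / 2) * norm (p z) \<le> M / sqrt k"
      using k(1) by (simp add: field_simps)
    moreover have "s powr (\<nu> + 1 / 2) * (norm (deriv h z) + norm (deriv g z)) \<le> s powr (\<nu> + 1 / 2) * (2 * norm (p z))"
      using p(2)[OF z] by (intro mult_left_mono) auto
    ultimately show ?thesis by (simp add: s_def)
  qed
  then show ?thesis
    using harm dec unfolding harmonic_Bloch_def mem_Collect_eq by (intro conjI exI[of _ h] exI[of _ g] bdd_aboveI2)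
qed

section \<open>Harmonicity and local injectivity from a decomposition\<close>

text \<open>The real derivative is \<open>x \<mapsto> deriv H z * x + cnj (deriv G z * x)\<close>.
  Combining its values at 1 and \<open>\<i>\<close> cancels the conjugate part in
  \<open>wirtinger\<close> and the holomorphic part in \<open>wirtinger_bar\<close>. A general
  \<open>F\<close> allows reuse for the Wirtinger derivatives themselves.\<close>

lemma
  assumes "H holomorphic_on unit_disk" "G holomorphic_on unit_disk"
    and "\<And>z. z \<in> unit_disk \<Longrightarrow> F z = H z + cnj (G z)"
  shows differentiable_on_harmonic: "F differentiable_on unit_disk"
    and wirtinger_harmonic: "\<And>z. z \<in> unit_disk \<Longrightarrow> wirtinger F z = deriv H z"
    and wirtinger_bar_harmonic: "\<And>z. z \<in> unit_disk \<Longrightarrow> wirtinger_bar F z = cnj (deriv G z)"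
    and C1_on_harmonic: "C1_on unit_disk F"
proof -
  have der: "(F has_derivative (\<lambda>x. deriv H z * x + cnj (deriv G z * x))) (at z)" if "z \<in> unit_disk" for z
    using assms that by (intro has_derivative_harmonic[OF open_ball])
  show diff: "F differentiable_on unit_disk"
    unfolding differentiable_on_def
    using der differentiable_at_withinI differentiableI by blast
  have fd: "frechet_derivative F (at z) = (\<lambda>x. deriv H z * x + cnj (deriv G z * x))" if "z \<in> unit_disk" for z
    using frechet_derivative_at[OF der[OF that]] by simp
  show w: "wirtinger F z = deriv H z" if "z \<in> unit_disk" for z
    using fd[OF that] by (simp add: wirtinger_def algebra_simps)
  show wb: "wirtinger_bar F z = cnj (deriv G z)" if "z \<in> unit_disk" for z
    using fd[OF that] by (simp add: wirtinger_bar_def algebra_simps)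
  have "continuous_on unit_disk (deriv H)" "continuous_on unit_disk (deriv G)"
    using holomorphic_deriv[OF _ open_ball] assms(1,2) holomorphic_on_imp_continuous_on by blast+
  then show "C1_on unit_disk F"
    unfolding C1_on_def
    by (intro conjI diff continuous_on_eq[OF _ w[symmetric]] continuous_on_eq[OF _ wb[symmetric]] continuous_on_cnj)
qed

text \<open>The Wirtinger derivatives \<open>deriv h\<close> and \<open>cnj (deriv g)\<close> are
  again sums of the same kind with one part zero, so the preceding facts apply a second
  time.\<close>

lemma harmonic_mapping_if_canonical_decomposition:
  assumes "canonical_decomposition f h g"
  shows "harmonic_mapping f"
proof -
  have hol: "h holomorphic_on unit_disk" "g holomorphic_on unit_disk"
    and f: "\<And>z. z \<in> unit_disk \<Longrightarrow> f z = h z + cnj (g z)"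
    using assms by (auto simp: canonical_decomposition_def)
  have dhol: "deriv h holomorphic_on unit_disk" "deriv g holomorphic_on unit_disk"
    using holomorphic_deriv hol open_ball by blast+
  \<comment> \<open>\<open>cnj 0\<close> and \<open>0 +\<close> exhibit the constant zero function
    as the missing part.\<close>
  have w: "wirtinger f z = deriv h z + cnj 0" "wirtinger_bar f z = 0 + cnj (deriv g z)" if "z \<in> unit_disk" for z
    using wirtinger_harmonic[OF hol f] wirtinger_bar_harmonic[OF hol f] that by auto
  show ?thesis
    unfolding harmonic_mapping_def C2_on_def
    using differentiable_on_harmonic[OF hol f] C1_on_harmonic[OF dhol(1) holomorphic_on_const w(1)]
      C1_on_harmonic[OF holomorphic_on_const dhol(2) w(2)]
      wirtinger_bar_harmonic[OF dhol(1) holomorphic_on_const w(1)]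
    by simp
qed

text \<open>Near \<open>z\<close>, both \<open>h\<close> and \<open>g\<close> differ from their
  linear parts at \<open>z\<close> by maps with Lipschitz constant \<open>e\<close>. Equal values at
  distinct \<open>x\<close> and \<open>y\<close> would then contradict the dominance of
  \<open>deriv h z\<close>.\<close>

lemma harmonic_locally_injective:
  assumes S: "open S" "z \<in> S" and hol: "h holomorphic_on S" "g holomorphic_on S"
    and less: "norm (deriv g z) < norm (deriv h z)"
  obtains r where "r > 0" "ball z r \<subseteq> S" "inj_on (\<lambda>w. h w + cnj (g w)) (ball z r)"
proof -
  \<comment> \<open>A third of the gap, so that the two errors, \<open>2 * e\<close> together, do
    not fill it.\<close>
  define e where "e = (norm (deriv h z) - norm (deriv g z)) / 3"
  have e: "e > 0" using less by (simp add: e_def)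
  obtain R where R: "R > 0" "ball z R \<subseteq> S" using S open_contains_ball by blast
  have ev: "\<forall>\<^sub>F w in nhds z. norm (deriv F w - deriv F z) < e" if "F holomorphic_on S" for F
  proof -
    have "isCont (deriv F) z"
      using holomorphic_deriv[OF that S(1)] S holomorphic_on_imp_continuous_on continuous_on_eq_continuous_at by blast
    then have "(deriv F \<longlongrightarrow> deriv F z) (nhds z)"
      by (simp add: continuous_within tendsto_at_iff_tendsto_nhds)
    from tendstoD[OF this e] show ?thesis by (simp add: dist_norm)
  qed
  from eventually_conj[OF ev[OF hol(1)] ev[OF hol(2)]]
  obtain d where d: "d > 0" "\<And>w. dist w z < d \<Longrightarrow> norm (deriv h w - deriv h z) < e \<and> norm (deriv g w - deriv g z) < e"
    unfolding eventually_nhds_metric by auto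
  define r where "r = min d R"
  have lip: "norm ((F x - deriv F z * x) - (F y - deriv F z * y)) \<le> e * norm (x - y)"
    if F: "F holomorphic_on S" "\<And>w. dist w z < d \<Longrightarrow> norm (deriv F w - deriv F z) < e"
      and xy: "x \<in> ball z r" "y \<in> ball z r" for F x y
  proof (rule field_differentiable_bound[OF convex_ball _ _ xy])
    fix w assume w: "w \<in> ball z r"
    then have "w \<in> S" using R(2) by (auto simp: r_def)
    then have "(F has_field_derivative deriv F w) (at w within ball z r)"
      using holomorphic_derivI[OF F(1) S(1)] has_field_derivative_at_within by blast
    then show "((\<lambda>x. F x - deriv F z * x) has_field_derivative (deriv F w - deriv F z)) (at w within ball z r)"
      by (auto intro!: derivative_eq_intros)
    show "norm (deriv F w - deriv F z) \<le> e"
      using F(2)[of w] w by (simp add: r_def dist_commute less_imp_le)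
  qed
  have "inj_on (\<lambda>w. h w + cnj (g w)) (ball z r)"
  proof
    fix x y assume xy: "x \<in> ball z r" "y \<in> ball z r" and eq: "h x + cnj (g x) = h y + cnj (g y)"
    let ?H = "(h x - deriv h z * x) - (h y - deriv h z * y)"
    let ?G = "(g x - deriv g z * x) - (g y - deriv g z * y)"
    have "?H + cnj ?G = (h x + cnj (g x)) - (h y + cnj (g y)) - (deriv h z * (x - y) + cnj (deriv g z * (x - y)))"
      by (simp add: algebra_simps)
    then have "deriv h z * (x - y) = - (?H + cnj ?G) - cnj (deriv g z * (x - y))"
      using eq by (simp add: algebra_simps)
    then have "norm (deriv h z * (x - y)) \<le> norm ?H + norm ?G + norm (deriv g z * (x - y))"
      by (smt (verit) complex_mod_cnj norm_minus_cancel norm_triangle_ineq norm_triangle_ineq4)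
    then have "norm (deriv h z) * norm (x - y) \<le> (2 * e + norm (deriv g z)) * norm (x - y)"
      using lip[OF hol(1) conjunct1[OF d(2)] xy] lip[OF hol(2) conjunct2[OF d(2)] xy]
      unfolding norm_mult distrib_right by linarith
    moreover have "2 * e + norm (deriv g z) < norm (deriv h z)"
      using less by (simp add: e_def field_simps)
    ultimately have "norm (x - y) \<le> 0"
      by (smt (verit) mult_strict_right_mono norm_ge_zero)
    then show "x = y" by simp
  qed
  then show ?thesis
    using R d(1) by (intro that[of r]) (auto simp: r_def)
qed

section \<open>Sharpness of the constant 1/2\<close>

text \<open>With \<open>deriv g z = z * deriv h z\<close> the Jacobian is exactly
  \<open>(1 - (norm z)\<^sup>2) * (norm (deriv h z))\<^sup>2\<close>. The starred bound follows from
  \<open>1 - (norm z)\<^sup>2 \<le> 2 * norm (1 - z)\<close>, while at the point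
  \<open>1 - t\<close> of the radius towards 1 the other expression is at least
  \<open>t powr (c - 1 / 2)\<close>.\<close>

lemma harmonic_Bloch_sharpness:
  fixes \<nu> c :: real
  assumes "\<nu> > 0" and c: "c < 1 / 2" "\<nu> + c > 0"
  obtains f where "harmonic_mapping f" "locally_univalent f"
    "f \<in> harmonic_Bloch_star \<nu>" "f \<notin> harmonic_Bloch (\<nu> + c)"
proof -
  \<comment> \<open>\<open>1 - z\<close> has positive real part on the disc, so the principal branch
    is holomorphic there.\<close>
  define p where "p = (\<lambda>z::complex. (1 - z) powr of_real (- (\<nu> + 1 / 2)))"
  have re: "Re z < 1" if "z \<in> unit_disk" for z
    using that complex_Re_le_cmod[of z] by simp
  have nonneg: "1 - z \<notin> \<real>\<^sub>\<le>\<^sub>0" if "z \<in> unit_disk" for z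
    using re[OF that] by (simp add: complex_nonpos_Reals_iff)
  have holp: "p holomorphic_on unit_disk"
    unfolding p_def using nonneg by (intro holomorphic_intros) auto
  then have holq: "(\<lambda>z. z * p z) holomorphic_on unit_disk"
    by (intro holomorphic_intros)
  have np: "norm (p z) = norm (1 - z) powr - (\<nu> + 1 / 2)" for z
    unfolding p_def by (subst norm_powr_real_powr') auto
  have ppos: "norm (p z) > 0" if "z \<in> unit_disk" for z
    using re[OF that] by (auto simp: np)
  obtain h where h: "\<And>z. z \<in> unit_disk \<Longrightarrow> (h has_field_derivative p z) (at z)"
    using holomorphic_convex_primitive'[OF convex_ball open_ball holp] at_within_open[OF _ open_ball] by metis
  obtain g0 where "\<And>z. z \<in> unit_disk \<Longrightarrow> (g0 has_field_derivative z * p z) (at z)"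
    using holomorphic_convex_primitive'[OF convex_ball open_ball holq] at_within_open[OF _ open_ball] by metis
  then have g: "((\<lambda>z. g0 z - g0 0) has_field_derivative z * p z) (at z)" if "z \<in> unit_disk" for z
    using that by (auto intro!: derivative_eq_intros)
  define g where "g = (\<lambda>z. g0 z - g0 0)"
  define f where "f = (\<lambda>z. h z + cnj (g z))"
  have d: "deriv h z = p z" "deriv g z = z * p z" if "z \<in> unit_disk" for z
    using h[OF that] g[OF that] by (auto simp: g_def intro: DERIV_imp_deriv)
  have hol: "h holomorphic_on unit_disk" "g holomorphic_on unit_disk"
    unfolding g_def holomorphic_on_open[OF open_ball] using h g by blast+
  have dec: "canonical_decomposition f h g"
    using hol by (auto simp: canonical_decomposition_def f_def g_def)
  then have harm: "harmonic_mapping f"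
    by (rule harmonic_mapping_if_canonical_decomposition)
  have "locally_univalent f"
    unfolding locally_univalent_def
  proof
    fix z :: complex assume z: "z \<in> unit_disk"
    have "norm (deriv g z) < norm (deriv h z)"
      using z ppos[OF z] by (simp add: d norm_mult)
    from harmonic_locally_injective[OF open_ball z hol this]
    obtain r where "r > 0" "ball z r \<subseteq> unit_disk" "inj_on f (ball z r)"
      unfolding f_def by metis
    then show "\<exists>U. open U \<and> z \<in> U \<and> U \<subseteq> unit_disk \<and> inj_on f U"
      by (intro exI[of _ "ball z r"]) auto
  qed
  moreover have "f \<in> harmonic_Bloch_star \<nu>"
  proof -
    have "(1 - (norm z)\<^sup>2) powr \<nu> * sqrt \<bar>jacobian h g z\<bar> \<le> 2 powr (\<nu> + 1 / 2)" if z: "z \<in> unit_disk" for z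
    proof -
      define s m where "s = 1 - (norm z)\<^sup>2" and "m = norm (1 - z)"
      have s: "s > 0" using z by (simp add: s_def abs_square_less_1)
      have m: "m > 0" using re[OF z] by (auto simp: m_def)
      have "jacobian h g z = (norm (p z))\<^sup>2 * s"
        using z by (simp add: jacobian_def d s_def norm_mult power_mult_distrib algebra_simps)
      then have "s powr \<nu> * sqrt \<bar>jacobian h g z\<bar> = s powr (\<nu> + 1 / 2) * m powr - (\<nu> + 1 / 2)"
        using s by (simp add: real_sqrt_mult np m_def powr_add powr_half_sqrt abs_mult)
      also have "\<dots> = (s / m) powr (\<nu> + 1 / 2)"
        by (simp only: powr_divide powr_minus_divide times_divide_eq_right mult_1_right)
      also have "\<dots> \<le> 2 powr (\<nu> + 1 / 2)"
      proof (rule powr_mono2)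
        have "s = (1 + norm z) * (1 - norm z)" by (simp add: s_def power2_eq_square algebra_simps)
        also have "\<dots> \<le> 2 * (1 - norm z)" using z by (intro mult_right_mono) auto
        also have "\<dots> \<le> 2 * m" using norm_triangle_ineq2[of 1 z] by (simp add: m_def)
        finally show "s / m \<le> 2" using m by (simp add: field_simps)
      qed (use s m assms in auto)
      finally show ?thesis by (simp add: s_def)
    qed
    then show ?thesis
      using harm dec unfolding harmonic_Bloch_star_def mem_Collect_eq by (intro conjI exI[of _ h] exI[of _ g] bdd_aboveI2)
  qed
  moreover have "f \<notin> harmonic_Bloch (\<nu> + c)"
  proof
    assume "f \<in> harmonic_Bloch (\<nu> + c)"
    then obtain h' g' M where dec': "canonical_decomposition f h' g'"
      and M: "\<And>z. z \<in> unit_disk \<Longrightarrow> (1 - (norm z)\<^sup>2) powr (\<nu> + c) * (norm (deriv h' z) + norm (deriv g' z)) \<le> M"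
      unfolding harmonic_Bloch_def bdd_above_def by blast
    \<comment> \<open>Membership yields some decomposition; uniqueness identifies \<open>h'\<close>
      with \<open>h\<close> on the disc.\<close>
    have dh': "deriv h' z = p z" if z: "z \<in> unit_disk" for z
    proof -
      have "deriv h' z = deriv h z"
        using dec' hol(1) z canonical_decomposition_unique(1)[OF dec' dec]
        by (intro complex_derivative_transform_within_open[of _ unit_disk]) (auto simp: canonical_decomposition_def)
      then show ?thesis using d(1)[OF z] by simp
    qed
    \<comment> \<open>\<open>t\<close> solves \<open>t powr (c - 1 / 2) = L\<close> with
      \<open>L > M\<close>; it lies below 1 because the exponent is negative and
      \<open>L > 1\<close>.\<close>
    define L t where "L = \<bar>M\<bar> + 2" and "t = L powr (1 / (c - 1 / 2))"
    have L: "L > 1" by (simp add: L_def)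
    have t0: "t > 0" using L by (simp add: t_def)
    have t1: "t < 1" using L c(1) powr_less_mono[of "1 / (c - 1 / 2)" 0 L] by (simp add: t_def divide_neg_neg)
    let ?x = "of_real (1 - t) :: complex"
    have nx: "norm ?x = 1 - t" unfolding norm_of_real using t1 by simp
    then have x: "?x \<in> unit_disk" using t0 by simp
    have "L = t powr (c - 1 / 2)" using c(1) L by (simp add: t_def powr_powr)
    also have "\<dots> = t powr (\<nu> + c) * t powr - (\<nu> + 1 / 2)"
      by (simp flip: powr_add)
    also have "t powr - (\<nu> + 1 / 2) = norm (p ?x)"
      using t0 by (simp add: np)
    \<comment> \<open>Here \<open>\<nu> + c > 0\<close> makes the power monotone, and
      \<open>1 - (1 - t)\<^sup>2 = 2 * t - t\<^sup>2\<close> is at least \<open>t\<close>.\<close>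
    also have "t powr (\<nu> + c) * norm (p ?x) \<le> (1 - (norm ?x)\<^sup>2) powr (\<nu> + c) * norm (p ?x)"
    proof (intro mult_right_mono powr_mono2)
      have "t * t \<le> t" using t0 t1 by simp
      then show "t \<le> 1 - (norm ?x)\<^sup>2"
        unfolding nx power2_eq_square by (simp add: algebra_simps)
    qed (use t0 c in auto)
    also have "\<dots> \<le> (1 - (norm ?x)\<^sup>2) powr (\<nu> + c) * (norm (deriv h' ?x) + norm (deriv g' ?x))"
      by (intro mult_left_mono) (use dh'[OF x] in auto)
    also have "\<dots> \<le> M" using M[OF x] .
    finally show False by (simp add: L_def)
  qed
  ultimately show ?thesis using that harm by blast
qed

theorem proposition4:
  fixes \<nu> :: real
  assumes "\<nu> > 0"
  shows "(\<forall>f. harmonic_mapping f \<and> locally_univalent f \<and> f \<in> harmonic_Bloch_star \<nu> \<longrightarrow>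
            f \<in> harmonic_Bloch (\<nu> + 1 / 2)) \<and>
         (\<forall>c::real. c < 1 / 2 \<and> \<nu> + c > 0 \<longrightarrow>
            (\<exists>f. harmonic_mapping f \<and> locally_univalent f \<and>
                 f \<in> harmonic_Bloch_star \<nu> \<and> f \<notin> harmonic_Bloch (\<nu> + c)))"
proof (intro conjI allI impI; elim conjE)
  show "f \<in> harmonic_Bloch (\<nu> + 1 / 2)"
    if "harmonic_mapping f" "locally_univalent f" "f \<in> harmonic_Bloch_star \<nu>" for f
    using locally_univalent_Bloch_star_imp_Bloch[OF that] .
  show "\<exists>f. harmonic_mapping f \<and> locally_univalent f \<and>
      f \<in> harmonic_Bloch_star \<nu> \<and> f \<notin> harmonic_Bloch (\<nu> + c)"
    if "c < 1 / 2" "\<nu> + c > 0" for c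
    using harmonic_Bloch_sharpness[OF assms that] by blast
qed

end
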